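(* Let $\alpha \in \mathbb{N}$ with $\alpha \geq 2$, and let $n$ be a positive integer divisible by $2\alpha+2$ with $n \geq 4\alpha+4$. Then there exists a circular arc graph $G$ on $n$ vertices whose maximum degree is $$\Delta = \frac{n(\alpha-1)}{2\alpha} + \frac{n}{2\alpha(\alpha+1)} + (\alpha+2)$$ and such that $box(G) > \alpha$.
   Context: All graphs are simple, finite and undirected. A circular arc graph is a graph that is the intersection graph of a family of arcs on a circle: each vertex is assigned an arc, and two distinct vertices are adjacent if and only if their arcs intersect. A $k$-dimensional box (or $k$-box) is a Cartesian product $R_1 \times \cdots \times R_k$ where each $R_i$ is a closed interval on the real line. The boxicity $box(G)$ of a graph $G$ is the minimum integer $k$ such that $G$ is the intersection graph of a family of $k$-boxes (one box per vertex; two distinct vertices are adjacent if and only if their boxes intersect). *)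

theory Defs
  imports "HOL-Analysis.Analysis" "Graph_Theory.Graph_Theory"
begin

(* Finite simple undirected graphs are the symmetric loop-free finite pair digraphs
   (locale pair_graph): each undirected edge is the pair of opposite arcs (u, v), (v, u),
   so the degree of a vertex is its out-degree. *)

definition max_degree :: "'a pair_pre_digraph \<Rightarrow> nat" where
  "max_degree G = Max (out_degree (with_proj G) ` pverts G)"

(* The family S is indexed by the vertices; different vertices may receive the same set. *)
definition intersection_graph_of :: "'a pair_pre_digraph \<Rightarrow> ('a \<Rightarrow> 'b set) \<Rightarrow> bool" where
  "intersection_graph_of G S \<longleftrightarrow>
     (\<forall>u\<in>pverts G. \<forall>v\<in>pverts G. u \<noteq> v \<longrightarrow> ((u, v) \<in> parcs G \<longleftrightarrow> S u \<inter> S v \<noteq> {}))"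

(* Closed, non-degenerate, proper arcs of the unit circle. For finite graphs, also allowing
   single points or the whole circle as arcs gives the same class of circular arc graphs. *)
definition circle_arc :: "complex set \<Rightarrow> bool" where
  "circle_arc A \<longleftrightarrow> (\<exists>a b :: real. a < b \<and> b < a + 2 * pi \<and> A = cis ` {a..b})"

definition circular_arc_graph :: "'a pair_pre_digraph \<Rightarrow> bool" where
  "circular_arc_graph G \<longleftrightarrow> pair_graph G \<and>
     (\<exists>S. (\<forall>v\<in>pverts G. circle_arc (S v)) \<and> intersection_graph_of G S)"

(* Points of k-dimensional space are functions on the coordinates {..<k}, extended by
   undefined; the only 0-box is a single point, so complete graphs have boxicity 0. *)
definition kbox :: "nat \<Rightarrow> (nat \<Rightarrow> real) set \<Rightarrow> bool" where
  "kbox k B \<longleftrightarrow>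
     (\<exists>l u :: nat \<Rightarrow> real. (\<forall>i<k. l i \<le> u i) \<and> B = (\<Pi>\<^sub>E i\<in>{..<k}. {l i..u i}))"

definition box_representable :: "'a pair_pre_digraph \<Rightarrow> nat \<Rightarrow> bool" where
  "box_representable G k \<longleftrightarrow>
     (\<exists>S. (\<forall>v\<in>pverts G. kbox k (S v)) \<and> intersection_graph_of G S)"

(* The minimum is attained: every finite simple graph has a box representation with one
   coordinate per vertex. *)
definition boxicity :: "'a pair_pre_digraph \<Rightarrow> nat" where
  "boxicity G = (LEAST k. box_representable G k)"

end

theory Submission
  imports Defs "HOL-Number_Theory.Cong"
begin

text \<open>Put \<open>k = \<alpha> + 1\<close> and \<open>n = 2 * k * m\<close>. Choose \<open>2 * k\<close> equidistant points on the circle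
  and, for each of them, a big arc from just after that point to just before the antipodal
  point. Two big arcs are disjoint only if they are antipodal, so these arcs induce the complement
  of a perfect matching on \<open>2 * k\<close> vertices. In a box representation every antipodal pair is
  separated in some coordinate, and one coordinate cannot separate two pairs; hence the boxicity
  is at least \<open>k\<close>.

  To reach \<open>n\<close> vertices at a low degree, put \<open>m - 1\<close> small arcs around each of the
  \<open>2 * k\<close> points, where only \<open>k - 1\<close> big arcs pass. One small arc per point is made just long
  enough to touch also the big arcs ending and starting there. Every big arc then has degree
  \<open>(2 * k - 2) + (k + 1) + (m - 2) * (k - 1) = \<alpha> * (m + 1) + 2\<close>, which is the required
  \<open>\<Delta>\<close>, while a small arc has degree at most \<open>(k + 1) + (m - 2)\<close>.\<close>

section \<open>Intersection of arcs and of boxes in terms of endpoints\<close>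

text \<open>Two angles give the same point exactly if they differ by full turns, so the question is
  whether some translate of \<open>{c..d}\<close> by \<open>t\<close> turns meets
  \<open>{a..b}\<close> on the real line.\<close>

lemma cis_arcs_meet_iff:
  fixes a b c d :: real
  assumes "a \<le> b" "c \<le> d"
  shows "cis ` {a..b} \<inter> cis ` {c..d} \<noteq> {} \<longleftrightarrow>
    (\<exists>t::int. a \<le> d + 2 * pi * t \<and> c + 2 * pi * t \<le> b)" (is "?L \<longleftrightarrow> ?R")
proof
  assume ?L
  then obtain x y where xy: "x \<in> {a..b}" "y \<in> {c..d}" "cis x = cis y"
    by blast
  then have "sin x = sin y \<and> cos x = cos y"
    by (simp add: cis.code)
  then obtain t :: int where "x = y + 2 * pi * t"
    using sin_cos_eq_iff by metis
  with xy show ?R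
    by (intro exI[of _ t]) auto
next
  assume ?R
  then obtain t :: int where t: "a \<le> d + 2 * pi * t" "c + 2 * pi * t \<le> b"
    by blast
  \<comment> \<open>The larger of the two left ends lies in both intervals.\<close>
  define x where "x = max a (c + 2 * pi * t)"
  have "x \<in> {a..b}" "x - 2 * pi * t \<in> {c..d}"
    using t assms by (auto simp: x_def)
  moreover have "cis x = cis (x - 2 * pi * t)"
    using sin_cos_eq_iff[of x "x - 2 * pi * t"] by (auto simp: cis.code)
  ultimately show ?L
    by blast
qed

lemma kboxes_meet_iff:
  fixes l u l' u' :: "nat \<Rightarrow> real"
  assumes "\<forall>i<k. l i \<le> u i" "\<forall>i<k. l' i \<le> u' i"
  shows "(\<Pi>\<^sub>E i\<in>{..<k}. {l i..u i}) \<inter> (\<Pi>\<^sub>E i\<in>{..<k}. {l' i..u' i}) \<noteq> {} \<longleftrightarrow>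
    (\<forall>i<k. l i \<le> u' i \<and> l' i \<le> u i)"
proof -
  have "(\<Pi>\<^sub>E i\<in>{..<k}. {l i..u i}) \<inter> (\<Pi>\<^sub>E i\<in>{..<k}. {l' i..u' i}) \<noteq> {} \<longleftrightarrow>
      (\<forall>i<k. {l i..u i} \<inter> {l' i..u' i} \<noteq> {})"
    by (auto simp: PiE_Int PiE_eq_empty_iff simp del: Int_atLeastAtMost)
  also have "\<dots> \<longleftrightarrow> (\<forall>i<k. l i \<le> u' i \<and> l' i \<le> u i)"
    using assms by auto
  finally show ?thesis .
qed

section \<open>Existence of box representations and a lower bound for boxicity\<close>

text \<open>The box of a vertex \<open>v\<close> has the \<open>w\<close>-th projection \<open>{0}\<close> if \<open>v = w\<close>,
  \<open>[0, 1]\<close> if \<open>v\<close> is adjacent to \<open>w\<close>, and \<open>{1}\<close> otherwise.\<close>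

lemma box_representable_card:
  fixes G :: "'a pair_pre_digraph"
  assumes "pair_graph G"
  shows "box_representable G (card (pverts G))"
proof -
  interpret pair_graph G by fact
  obtain e where e: "bij_betw e {..<card (pverts G)} (pverts G)"
    using pair_finite_verts ex_bij_betw_nat_finite[of "pverts G"] by (auto simp: atLeast0LessThan)
  have symG: "(v, w) \<in> parcs G \<longleftrightarrow> (w, v) \<in> parcs G" for v w
    using pair_sym_arcs by (auto simp: symmetric_def dest: symD)
  define l where "l v i = (if v = e i \<or> (v, e i) \<in> parcs G then 0 else 1 :: real)" for v i
  define u where "u v i = (if v = e i then 0 else 1 :: real)" for v i
  define B where "B v = (\<Pi>\<^sub>E i\<in>{..<card (pverts G)}. {l v i..u v i})" for v
  have lu: "\<forall>i<card (pverts G). l v i \<le> u v i" for v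
    by (simp add: l_def u_def)
  have "intersection_graph_of G B"
    unfolding intersection_graph_of_def B_def kboxes_meet_iff[OF lu lu]
  proof (intro ballI impI)
    fix v w assume vw: "v \<in> pverts G" "w \<in> pverts G" "v \<noteq> w"
    then have "v \<in> e ` {..<card (pverts G)}"
      using bij_betw_imp_surj_on[OF e] by simp
    then obtain i where i: "i < card (pverts G)" "e i = v"
      by blast
    show "(v, w) \<in> parcs G \<longleftrightarrow>
        (\<forall>i<card (pverts G). l v i \<le> u w i \<and> l w i \<le> u v i)"
    proof
      assume "(v, w) \<in> parcs G"
      moreover from this have "(w, v) \<in> parcs G"
        using symG[of v w] by simp
      ultimately show "\<forall>i<card (pverts G). l v i \<le> u w i \<and> l w i \<le> u v i"
        using vw by (auto simp: l_def u_def)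
    next
      assume "\<forall>i<card (pverts G). l v i \<le> u w i \<and> l w i \<le> u v i"
      \<comment> \<open>In the coordinate belonging to \<open>v\<close> itself, \<open>v\<close> is
        reduced to \<open>{0}\<close>, and only neighbours of \<open>v\<close> reach down to
        0.\<close>
      then have "l w i \<le> u v i"
        using i by blast
      then have "(w, v) \<in> parcs G"
        using i vw by (simp add: l_def u_def split: if_splits)
      then show "(v, w) \<in> parcs G"
        using symG[of v w] by simp
    qed
  qed
  then show ?thesis
    unfolding box_representable_def kbox_def using lu B_def by blast
qed

text \<open>Choosing for each pair a coordinate that separates it gives an injection from the pairs
  into the coordinates.\<close>

lemma disjoint_pairs_box_dimension:
  fixes G :: "'a pair_pre_digraph"
  assumes rep: "box_representable G d"
    and inG: "\<And>i. i < k \<Longrightarrow> p i \<in> pverts G \<and> q i \<in> pverts G \<and> p i \<noteq> q i"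
    and nonadj: "\<And>i. i < k \<Longrightarrow> (p i, q i) \<notin> parcs G"
    and adj: "\<And>i j v w. \<lbrakk>i < k; j < k; i \<noteq> j; v \<in> {p i, q i}; w \<in> {p j, q j}\<rbrakk>
      \<Longrightarrow> v \<noteq> w \<and> (v, w) \<in> parcs G"
  shows "k \<le> d"
proof -
  obtain S where S: "\<forall>v\<in>pverts G. kbox d (S v)" and int: "intersection_graph_of G S"
    using rep by (auto simp: box_representable_def)
  have "\<forall>v\<in>pverts G. \<exists>lu. (\<forall>i<d. fst lu i \<le> snd lu i) \<and>
      S v = (\<Pi>\<^sub>E i\<in>{..<d}. {fst lu i..snd lu i :: real})"
    using S by (auto simp: kbox_def)
  from bchoice[OF this] obtain f where f: "\<And>v. v \<in> pverts G \<Longrightarrow> \<forall>i<d. fst (f v) i \<le> snd (f v) i"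
      "\<And>v. v \<in> pverts G \<Longrightarrow> S v = (\<Pi>\<^sub>E i\<in>{..<d}. {fst (f v) i..snd (f v) i :: real})"
    by blast
  define l where "l v = fst (f v)" for v
  define u where "u v = snd (f v)" for v
  have arc_iff: "(v, w) \<in> parcs G \<longleftrightarrow> (\<forall>i<d. l v i \<le> u w i \<and> l w i \<le> u v i)"
    if "v \<in> pverts G" "w \<in> pverts G" "v \<noteq> w" for v w
  proof -
    have "(v, w) \<in> parcs G \<longleftrightarrow> S v \<inter> S w \<noteq> {}"
      using int that by (simp add: intersection_graph_of_def)
    also have "\<dots> \<longleftrightarrow> (\<forall>i<d. l v i \<le> u w i \<and> l w i \<le> u v i)"
      using kboxes_meet_iff[OF f(1) f(1), of v w] that f(2) by (simp add: l_def u_def)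
    finally show ?thesis .
  qed
  have "\<exists>c<d. u (p i) c < l (q i) c \<or> u (q i) c < l (p i) c" if "i < k" for i
    using arc_iff[of "p i" "q i"] inG[OF that] nonadj[OF that] by (meson not_le)
  then obtain c where c: "\<And>i. i < k \<Longrightarrow>
      c i < d \<and> (u (p i) (c i) < l (q i) (c i) \<or> u (q i) (c i) < l (p i) (c i))"
    by metis
  have "inj_on c {..<k}"
  proof (rule inj_onI, rule ccontr)
    fix i j assume ij: "i \<in> {..<k}" "j \<in> {..<k}" "c i = c j" "i \<noteq> j"
    have cross: "l v (c i) \<le> u w (c i) \<and> l w (c i) \<le> u v (c i)"
      if "v \<in> {p i, q i}" "w \<in> {p j, q j}" for v w
      using arc_iff[of v w] adj[of i j v w] that ij inG[of i] inG[of j] c[of i] by auto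
    \<comment> \<open>If \<open>p i\<close> lies below \<open>q i\<close> and \<open>p j\<close>
      below \<open>q j\<close> in this coordinate, then
      \<open>l (q i) \<le> u (p j) < l (q j) \<le> u (p i) < l (q i)\<close>; the other orders are
      symmetric.\<close>
    show False
      using c[of i] c[of j] ij cross[of "p i" "p j"] cross[of "p i" "q j"]
        cross[of "q i" "p j"] cross[of "q i" "q j"] by auto
  qed
  moreover have "c ` {..<k} \<subseteq> {..<d}"
    using c by auto
  ultimately show ?thesis
    using card_inj_on_le[of c "{..<k}" "{..<d}"] by simp
qed

text \<open>The \<open>LEAST\<close> in \<open>boxicity\<close> is itself a valid dimension because
  \<open>box_representable_card\<close> provides some representation.\<close>

lemma boxicity_ge_disjoint_pairs:
  fixes G :: "'a pair_pre_digraph"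
  assumes "pair_graph G"
    and "\<And>i. i < k \<Longrightarrow> p i \<in> pverts G \<and> q i \<in> pverts G \<and> p i \<noteq> q i"
    and "\<And>i. i < k \<Longrightarrow> (p i, q i) \<notin> parcs G"
    and "\<And>i j v w. \<lbrakk>i < k; j < k; i \<noteq> j; v \<in> {p i, q i}; w \<in> {p j, q j}\<rbrakk>
      \<Longrightarrow> v \<noteq> w \<and> (v, w) \<in> parcs G"
  shows "k \<le> boxicity G"
  unfolding boxicity_def
  by (rule disjoint_pairs_box_dimension[OF LeastI[of "box_representable G", OF box_representable_card[OF assms(1)]]
      assms(2-4)])

section \<open>Arcs on the circle and their intersections in integer coordinates\<close>

text \<open>The circle has circumference \<open>12 * k\<close>. A vertex \<open>v\<close> encodes the position
  \<open>v mod (2 * k)\<close>, whose point is \<open>6 * (v mod (2 * k))\<close>, and the layer \<open>v div (2 * k)\<close>: layer 0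
  consists of the big arcs, layer 1 of the longer small arcs. The ends of an arc are given
  relative to its point.\<close>

definition arc_lo :: "nat \<Rightarrow> int" where
  "arc_lo l = (if l = 0 then 2 else if l = 1 then - 2 else - 1)"

definition arc_hi :: "nat \<Rightarrow> nat \<Rightarrow> int" where
  "arc_hi k l = (if l = 0 then 6 * int k - 2 else if l = 1 then 2 else 1)"

definition layer_arc :: "nat \<Rightarrow> nat \<Rightarrow> complex set" where
  "layer_arc k v = cis `
     {pi / (6 * real k) * of_int (6 * int (v mod (2 * k)) + arc_lo (v div (2 * k))) ..
      pi / (6 * real k) * of_int (6 * int (v mod (2 * k)) + arc_hi k (v div (2 * k)))}"

definition layer_graph :: "nat \<Rightarrow> nat \<Rightarrow> nat pair_pre_digraph" where
  "layer_graph k m = \<lparr>pverts = {..<2 * k * m},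
     parcs = {(u, v). u < 2 * k * m \<and> v < 2 * k * m \<and> u \<noteq> v \<and>
       layer_arc k u \<inter> layer_arc k v \<noteq> {}}\<rparr>"

text \<open>Here \<open>d\<close> is the position of the second arc minus that of the first, and \<open>t\<close> counts full
  turns.\<close>

definition layers_meet :: "nat \<Rightarrow> nat \<Rightarrow> nat \<Rightarrow> int \<Rightarrow> bool" where
  "layers_meet k l l' d \<longleftrightarrow> (\<exists>t::int.
     arc_lo l - arc_hi k l' \<le> 6 * (d + 2 * int k * t) \<and>
     6 * (d + 2 * int k * t) \<le> arc_hi k l - arc_lo l')"

lemma arc_lo_less_hi: "k \<ge> 1 \<Longrightarrow> arc_lo l < arc_hi k l"
  by (simp add: arc_lo_def arc_hi_def)

lemma arc_hi_less_lo: "k \<ge> 1 \<Longrightarrow> arc_hi k l < arc_lo l + 12 * int k"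
  by (simp add: arc_lo_def arc_hi_def)

lemma circle_arc_layer_arc:
  assumes "k \<ge> 1"
  shows "circle_arc (layer_arc k v)"
proof -
  define s where "s = pi / (6 * real k)"
  have s: "s > 0" "2 * pi = s * of_int (12 * int k)"
    using assms by (auto simp: s_def)
  have "s * of_int x < s * of_int y" if "x < y" for x y :: int
    using that s by simp
  moreover have "s * of_int x < s * of_int y + 2 * pi" if "x < y + 12 * int k" for x y :: int
    unfolding s(2) distrib_left[symmetric] of_int_add[symmetric] using that s(1)
    by (simp del: of_int_add)
  ultimately show ?thesis
    unfolding circle_arc_def layer_arc_def s_def[symmetric]
    using arc_lo_less_hi[OF assms] arc_hi_less_lo[OF assms]
    by (intro exI conjI refl) (auto simp: add.assoc simp del: of_int_add)
qed

text \<open>Dividing by the angle \<open>s\<close> of one unit of length turns the criterion for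
  arcs into integer inequalities, in which a full turn is \<open>12 * k\<close>.\<close>

lemma layer_arcs_meet_iff:
  assumes "k \<ge> 1"
  shows "layer_arc k u \<inter> layer_arc k v \<noteq> {} \<longleftrightarrow>
    layers_meet k (u div (2 * k)) (v div (2 * k)) (int (v mod (2 * k)) - int (u mod (2 * k)))"
proof -
  define s where "s = pi / (6 * real k)"
  have s: "s > 0" "\<And>t. 2 * pi * of_int t = s * of_int (12 * int k * t)"
    using assms by (auto simp: s_def)
  have mono: "s * of_int x \<le> s * of_int y \<longleftrightarrow> x \<le> y" for x y :: int
    using s by simp
  have ends: "s * of_int (x + arc_lo l) \<le> s * of_int (x + arc_hi k l)" for x l
    using arc_lo_less_hi[OF assms, of l] unfolding mono by simp
  show ?thesis
    unfolding layer_arc_def s_def[symmetric] cis_arcs_meet_iff[OF ends ends] s(2)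
      distrib_left[symmetric] of_int_add[symmetric] mono layers_meet_def
    by (intro arg_cong[where f = Ex] ext) (auto simp: algebra_simps)
qed

lemma layers_meet_shift: "layers_meet k l l' (d + 2 * int k * s) \<longleftrightarrow> layers_meet k l l' d"
proof
  assume "layers_meet k l l' (d + 2 * int k * s)"
  then obtain t where
    "arc_lo l - arc_hi k l' \<le> 6 * (d + 2 * int k * s + 2 * int k * t)"
    "6 * (d + 2 * int k * s + 2 * int k * t) \<le> arc_hi k l - arc_lo l'"
    by (auto simp: layers_meet_def)
  then show "layers_meet k l l' d"
    unfolding layers_meet_def by (intro exI[of _ "s + t"]) (simp add: algebra_simps)
next
  assume "layers_meet k l l' d"
  then obtain t where
    "arc_lo l - arc_hi k l' \<le> 6 * (d + 2 * int k * t)"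
    "6 * (d + 2 * int k * t) \<le> arc_hi k l - arc_lo l'"
    by (auto simp: layers_meet_def)
  then show "layers_meet k l l' (d + 2 * int k * s)"
    unfolding layers_meet_def by (intro exI[of _ "t - s"]) (simp add: algebra_simps)
qed

text \<open>The admissible offsets lie strictly between minus one and plus one turn, so for
  \<open>0 \<le> d < 2 * k\<close> only \<open>t = 0\<close> and \<open>t = - 1\<close>
  remain.\<close>

lemma layers_meet_sub_period:
  assumes "d < 2 * k"
  shows "layers_meet k l l' (int d) \<longleftrightarrow>
    (\<exists>D\<in>{int d, int d - 2 * int k}.
      arc_lo l - arc_hi k l' \<le> 6 * D \<and> 6 * D \<le> arc_hi k l - arc_lo l')"
proof
  assume "layers_meet k l l' (int d)"
  then obtain t D where D: "D = int d + 2 * int k * t"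
    and t: "arc_lo l - arc_hi k l' \<le> 6 * D" "6 * D \<le> arc_hi k l - arc_lo l'"
    by (auto simp: layers_meet_def)
  have "arc_hi k l - arc_lo l' < 6 * (2 * int k)" "6 * (- 2 * int k) < arc_lo l - arc_hi k l'"
    using assms by (auto simp: arc_lo_def arc_hi_def)
  with t have "D < 2 * int k" "- 2 * int k < D"
    by linarith+
  then have "2 * int k * t < 2 * int k * 1" "2 * int k * (- 2) < 2 * int k * t"
    using assms unfolding D by linarith+
  moreover have "0 < 2 * int k"
    using assms by simp
  ultimately have "t < 1" "- 2 < t"
    by (simp_all only: mult_less_cancel_left_pos)
  then have "t = 0 \<or> t = - 1"
    by auto
  with t D show "\<exists>D\<in>{int d, int d - 2 * int k}.
      arc_lo l - arc_hi k l' \<le> 6 * D \<and> 6 * D \<le> arc_hi k l - arc_lo l'"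
    by auto
next
  assume "\<exists>D\<in>{int d, int d - 2 * int k}.
      arc_lo l - arc_hi k l' \<le> 6 * D \<and> 6 * D \<le> arc_hi k l - arc_lo l'"
  then show "layers_meet k l l' (int d)"
    unfolding layers_meet_def
    by (auto intro: exI[of _ "0::int"] exI[of _ "- 1::int"])
qed

text \<open>A big arc covers \<open>2\<close> to \<open>6 * k - 2\<close> past its point. Layer 1
  reaches exactly 2 to each side and, the arcs being closed, touches both ends (\<open>d = 0\<close>
  and \<open>d = k\<close>); later layers reach only 1 and miss them.\<close>

lemma layers_meet_big:
  assumes "d < 2 * k"
  shows "layers_meet k 0 l (int d) \<longleftrightarrow>
    (if l = 0 then d \<noteq> k else if l = 1 then d \<le> k else 0 < d \<and> d < k)"
  unfolding layers_meet_sub_period[OF assms] using assms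
  by (auto simp: arc_lo_def arc_hi_def)

text \<open>Neighbouring points are 6 apart and small arcs reach at most 2, so small arcs meet only
  at a common point. An implication is enough, since small arcs need only an upper bound on the
  degree.\<close>

lemma layers_meet_small:
  assumes "d < 2 * k" "l > 0" "layers_meet k l l' (int d)"
  shows "if l' = 0 then d = 0 \<or> k \<le> d else d = 0"
  using assms(2,3) unfolding layers_meet_sub_period[OF assms(1)] using assms(1)
  by (auto simp: arc_lo_def arc_hi_def split: if_splits)

section \<open>The layer graph and its boxicity\<close>

lemma pair_graph_layer_graph: "pair_graph (layer_graph k m)"
proof -
  have "finite (parcs (layer_graph k m))"
    by (rule finite_subset[of _ "{..<2 * k * m} \<times> {..<2 * k * m}"]) (auto simp: layer_graph_def)
  then show ?thesis
    by unfold_locales (auto simp: layer_graph_def symmetric_def intro!: symI)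
qed

lemma circular_arc_graph_layer_graph: "k \<ge> 1 \<Longrightarrow> circular_arc_graph (layer_graph k m)"
  unfolding circular_arc_graph_def
  by (intro conjI pair_graph_layer_graph exI[of _ "layer_arc k"])
    (auto simp: circle_arc_layer_arc intersection_graph_of_def layer_graph_def)

text \<open>The pairs are the antipodal big arcs: layer 0 consists of the vertices below
  \<open>2 * k\<close>, where only a position difference of \<open>k\<close> prevents
  adjacency.\<close>

lemma boxicity_layer_graph:
  assumes "m \<ge> 1"
  shows "k \<le> boxicity (layer_graph k m)"
proof (rule boxicity_ge_disjoint_pairs[where p = "\<lambda>i. i" and q = "\<lambda>i. i + k"])
  have bound: "v < 2 * k \<Longrightarrow> v < 2 * k * m" for v
    using assms by (metis One_nat_def less_le_trans mult_le_mono2 mult.right_neutral)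
  have arc_iff: "(u, v) \<in> parcs (layer_graph k m) \<longleftrightarrow> v - u \<noteq> k" if "u < v" "v < 2 * k" for u v
  proof -
    have "layer_arc k u \<inter> layer_arc k v \<noteq> {} \<longleftrightarrow> layers_meet k 0 0 (int (v - u))"
      using that by (subst layer_arcs_meet_iff) (auto simp: of_nat_diff)
    then show ?thesis
      using that bound[of u] bound[of v] layers_meet_big[of "v - u" k 0] by (auto simp: layer_graph_def)
  qed
  have sym: "(u, v) \<in> parcs (layer_graph k m) \<longleftrightarrow> (v, u) \<in> parcs (layer_graph k m)" for u v
    by (auto simp: layer_graph_def)
  show "pair_graph (layer_graph k m)"
    by (rule pair_graph_layer_graph)
  show "i \<in> pverts (layer_graph k m) \<and> i + k \<in> pverts (layer_graph k m) \<and> i \<noteq> i + k"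
    if "i < k" for i
    using that bound by (auto simp: layer_graph_def)
  show "(i, i + k) \<notin> parcs (layer_graph k m)" if "i < k" for i
    using that arc_iff[of i "i + k"] by auto
  show "v \<noteq> w \<and> (v, w) \<in> parcs (layer_graph k m)"
    if "i < k" "j < k" "i \<noteq> j" "v \<in> {i, i + k}" "w \<in> {j, j + k}" for i j v w
  proof -
    have "v < 2 * k" "w < 2 * k" "v \<noteq> w" "v - w \<noteq> k" "w - v \<noteq> k"
      using that by auto
    then show ?thesis
      using arc_iff[of v w] arc_iff[of w v] sym[of v w] by (cases "v < w") auto
  qed
qed

section \<open>Degrees in the layer graph\<close>

text \<open>Coordinates centred at the position of \<open>u\<close>: the vertex in layer \<open>l\<close> that is \<open>d\<close> positions
  further.\<close>

definition rel_vertex :: "nat \<Rightarrow> nat \<Rightarrow> nat \<times> nat \<Rightarrow> nat" where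
  "rel_vertex k u = (\<lambda>(l, d). 2 * k * l + (u + d) mod (2 * k))"

lemma inj_on_rel_vertex: "inj_on (rel_vertex k u) (UNIV \<times> {..<2 * k})"
proof (rule inj_onI, clarify)
  fix l d l' d' assume d: "d < 2 * k" "d' < 2 * k"
    and eq: "rel_vertex k u (l, d) = rel_vertex k u (l', d')"
  have k: "0 < 2 * k" using d by simp
  have "rel_vertex k u (l, d) div (2 * k) = l" "rel_vertex k u (l', d') div (2 * k) = l'"
    "rel_vertex k u (l, d) mod (2 * k) = (u + d) mod (2 * k)"
    "rel_vertex k u (l', d') mod (2 * k) = (u + d') mod (2 * k)"
    using k by (simp_all add: rel_vertex_def)
  with eq have "l = l'" and "[u + d = u + d'] (mod (2 * k))"
    by (auto simp: cong_def)
  then have "[d = d'] (mod (2 * k))"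
    by (simp only: cong_add_lcancel_nat)
  then have "d = d'"
    using d by (simp add: cong_def)
  with \<open>l = l'\<close> show "l = l' \<and> d = d'" ..
qed

lemma rel_vertex_cases:
  assumes "k \<ge> 1" "v < 2 * k * m"
  obtains l d where "l < m" "d < 2 * k" "v = rel_vertex k u (l, d)"
proof
  define w where "w = v mod (2 * k)"
  have w: "w < 2 * k" "u mod (2 * k) < 2 * k"
    using assms by (auto simp: w_def)
  \<comment> \<open>The position of \<open>v\<close> minus that of \<open>u\<close> modulo
    \<open>2 * k\<close>; adding \<open>2 * k\<close> first avoids truncated subtraction.\<close>
  define d where "d = (w + (2 * k - u mod (2 * k))) mod (2 * k)"
  have "(u + d) mod (2 * k) = (u mod (2 * k) + (w + (2 * k - u mod (2 * k)))) mod (2 * k)"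
    unfolding d_def by (simp add: mod_simps)
  also have "u mod (2 * k) + (w + (2 * k - u mod (2 * k))) = w + 2 * k"
    using w(2) by arith
  finally have "(u + d) mod (2 * k) = w"
    using w by simp
  then show "v = rel_vertex k u (v div (2 * k), d)"
    by (simp add: rel_vertex_def w_def)
  show "v div (2 * k) < m"
    using assms by (simp add: less_mult_imp_div_less mult.commute)
  show "d < 2 * k"
    using assms by (simp add: d_def)
qed

lemma layer_arc_meets_rel_vertex:
  assumes "d < 2 * k"
  shows "layer_arc k u \<inter> layer_arc k (rel_vertex k u (l, d)) \<noteq> {} \<longleftrightarrow>
    layers_meet k (u div (2 * k)) l (int d)"
proof -
  \<comment> \<open>The true position difference is \<open>d\<close> up to full turns, which
    \<open>layers_meet_shift\<close> absorbs.\<close>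
  have "int ((u + d) mod (2 * k)) - int (u mod (2 * k)) =
      int d + 2 * int k * (int (u div (2 * k)) - int ((u + d) div (2 * k)))"
    using mult_div_mod_eq[of "2 * int k" "int u + int d"] mult_div_mod_eq[of "2 * int k" "int u"]
    by (simp add: zmod_int zdiv_int algebra_simps)
  then show ?thesis
    using assms by (subst layer_arcs_meet_iff) (simp_all add: rel_vertex_def layers_meet_shift)
qed

lemma rel_vertex_less: "l < m \<Longrightarrow> d < 2 * k \<Longrightarrow> rel_vertex k u (l, d) < 2 * k * m"
proof -
  assume *: "l < m" "d < 2 * k"
  have "2 * k * l + (u + d) mod (2 * k) < 2 * k * Suc l"
    using * by simp
  also have "\<dots> \<le> 2 * k * m"
    using * by (intro mult_le_mono2) simp
  finally show ?thesis
    by (simp add: rel_vertex_def)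
qed

lemma rel_vertex_eq_self_iff:
  assumes "d < 2 * k"
  shows "rel_vertex k u (l, d) = u \<longleftrightarrow> l = u div (2 * k) \<and> d = 0"
proof -
  have "rel_vertex k u (u div (2 * k), 0) = u"
    by (simp add: rel_vertex_def)
  then show ?thesis
    using inj_onD[OF inj_on_rel_vertex, of k u "(l, d)" "(u div (2 * k), 0)"] assms by auto
qed

text \<open>By injectivity of \<open>rel_vertex\<close>, neighbours can be counted layer by layer
  through their offsets; the excluded pair is \<open>u\<close> itself.\<close>

lemma out_degree_layer_graph:
  assumes "k \<ge> 1" "u < 2 * k * m"
  shows "out_degree (with_proj (layer_graph k m)) u =
    (\<Sum>l<m. card {d. d < 2 * k \<and> layers_meet k (u div (2 * k)) l (int d) \<and>
      \<not> (l = u div (2 * k) \<and> d = 0)})"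
proof -
  define D where "D l = {d. d < 2 * k \<and> layers_meet k (u div (2 * k)) l (int d) \<and>
      \<not> (l = u div (2 * k) \<and> d = 0)}" for l
  have "out_arcs (with_proj (layer_graph k m)) u =
      Pair u ` {v. v < 2 * k * m \<and> v \<noteq> u \<and> layer_arc k u \<inter> layer_arc k v \<noteq> {}}"
    using assms by (auto simp: out_arcs_def layer_graph_def with_proj_def image_def)
  also have "{v. v < 2 * k * m \<and> v \<noteq> u \<and> layer_arc k u \<inter> layer_arc k v \<noteq> {}} =
      rel_vertex k u ` Sigma {..<m} D" (is "?N = ?I")
  proof
    show "?N \<subseteq> ?I"
    proof
      fix v assume v: "v \<in> ?N"
      then obtain l d where "l < m" "d < 2 * k" "v = rel_vertex k u (l, d)"
        using rel_vertex_cases[OF assms(1)] by blast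
      with v show "v \<in> ?I"
        by (auto simp: D_def layer_arc_meets_rel_vertex rel_vertex_eq_self_iff)
    qed
    show "?I \<subseteq> ?N"
      unfolding D_def
      by (auto simp del: ex_in_conv simp: layer_arc_meets_rel_vertex[THEN iffD2]
          rel_vertex_eq_self_iff rel_vertex_less)
  qed
  finally have "out_degree (with_proj (layer_graph k m)) u =
      card (Pair u ` rel_vertex k u ` Sigma {..<m} D)"
    by (simp add: out_degree_def)
  also have "\<dots> = card (Sigma {..<m} D)"
  proof -
    have "inj_on (rel_vertex k u) (Sigma {..<m} D)"
      by (rule inj_on_subset[OF inj_on_rel_vertex]) (auto simp: D_def)
    then show ?thesis
      by (simp add: card_image inj_on_def[of "Pair u"])
  qed
  also have "\<dots> = (\<Sum>l<m. card (D l))"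
    by (rule card_SigmaI) (auto simp: D_def)
  finally show ?thesis
    by (simp only: D_def)
qed

lemma out_degree_big:
  assumes "k \<ge> 1" "m \<ge> 2" "u < 2 * k"
  shows "out_degree (with_proj (layer_graph k m)) u = (k - 1) * (m + 1) + 2"
proof -
  obtain r where r: "m = Suc (Suc r)"
    using assms by (metis Suc_le_D numeral_2_eq_2 Suc_le_mono)
  have less: "u < 2 * k * m"
    using assms by (metis less_le_trans mult_le_mono2 mult.right_neutral One_nat_def Suc_1 Suc_leD)
  \<comment> \<open>Offset 0 is removed only here, since \<open>u\<close> itself lies in layer
    0.\<close>
  have big: "{d. d < 2 * k \<and> layers_meet k 0 0 (int d) \<and> d \<noteq> 0} = {1..<2 * k} - {k}"
    using layers_meet_big[of _ k 0] by auto
  have spanning: "{d. d < 2 * k \<and> layers_meet k 0 1 (int d)} = {..k}"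
    using layers_meet_big[of _ k 1] assms by auto
  have small: "{d. d < 2 * k \<and> layers_meet k 0 (Suc (Suc l)) (int d)} = {1..<k}" for l
    using layers_meet_big[of _ k "Suc (Suc l)"] by auto
  have "out_degree (with_proj (layer_graph k m)) u =
      card ({1..<2 * k} - {k}) + (card {..k} + (\<Sum>l<r. card {1..<k}))"
    unfolding out_degree_layer_graph[OF assms(1) less] unfolding r sum.lessThan_Suc_shift
    using assms(3) big spanning small by simp
  also have "\<dots> = (2 * k - 2) + (k + 1 + r * (k - 1))"
    using assms by simp
  also have "\<dots> = (k - 1) * (m + 1) + 2"
  proof -
    obtain a where "k = Suc a"
      using assms(1) by (metis Suc_le_D One_nat_def)
    then show ?thesis
      by (simp add: r algebra_simps)
  qed
  finally show ?thesis .
qed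

text \<open>Layer 0 contributes at most \<open>k + 1\<close>, every other layer at most its offset
  0. Counting the layer of \<open>u\<close> too makes the bound one larger than necessary.\<close>

lemma out_degree_small:
  assumes "k \<ge> 1" "m \<ge> 1" "2 * k \<le> u" "u < 2 * k * m"
  shows "out_degree (with_proj (layer_graph k m)) u \<le> k + m"
proof -
  obtain r where r: "m = Suc r"
    using assms(2) by (metis Suc_le_D One_nat_def)
  define D where "D l = {d. d < 2 * k \<and> layers_meet k (u div (2 * k)) l (int d) \<and>
      \<not> (l = u div (2 * k) \<and> d = 0)}" for l
  have pos: "u div (2 * k) > 0"
    using assms by (simp add: div_greater_zero_iff)
  have "d \<in> insert 0 {k..<2 * k}" if "d \<in> D 0" for d
    using that layers_meet_small[of d k "u div (2 * k)" 0] pos by (auto simp: D_def)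
  then have "card (D 0) \<le> card (insert 0 {k..<2 * k})"
    by (intro card_mono subsetI) simp_all
  then have big: "card (D 0) \<le> k + 1"
    using assms by simp
  have "d \<in> {0}" if "d \<in> D (Suc l)" for d l
    using that layers_meet_small[of d k "u div (2 * k)" "Suc l"] pos by (auto simp: D_def)
  then have "card (D (Suc l)) \<le> card {0::nat}" for l
    by (intro card_mono subsetI) simp_all
  then have "(\<Sum>l<r. card (D (Suc l))) \<le> r"
    using sum_bounded_above[of "{..<r}" "\<lambda>l. card (D (Suc l))" 1] by simp
  with big show ?thesis
    unfolding out_degree_layer_graph[OF assms(1,4)] D_def[symmetric] unfolding r sum.lessThan_Suc_shift
    by simp
qed

lemma max_degree_layer_graph:
  assumes "k \<ge> 2" "m \<ge> 2"
  shows "max_degree (layer_graph k m) = (k - 1) * (m + 1) + 2"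
  unfolding max_degree_def
proof (rule Max_eqI)
  show "finite (out_degree (with_proj (layer_graph k m)) ` pverts (layer_graph k m))"
    by (simp add: layer_graph_def)
  have "out_degree (with_proj (layer_graph k m)) 0 = (k - 1) * (m + 1) + 2"
    using assms by (intro out_degree_big) auto
  moreover have "0 \<in> pverts (layer_graph k m)"
    using assms by (simp add: layer_graph_def)
  ultimately show "(k - 1) * (m + 1) + 2 \<in>
      out_degree (with_proj (layer_graph k m)) ` pverts (layer_graph k m)"
    by (metis imageI)
  obtain a where a: "k = Suc (Suc a)"
    using assms(1) by (metis Suc_le_D numeral_2_eq_2 Suc_le_mono)
  \<comment> \<open>The difference of the two sides is \<open>(k - 2) * m + 1\<close>, so the big
    arcs attain the maximum.\<close>
  have "k + m \<le> (k - 1) * (m + 1) + 2"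
    by (simp add: a)
  show "y \<le> (k - 1) * (m + 1) + 2"
    if y: "y \<in> out_degree (with_proj (layer_graph k m)) ` pverts (layer_graph k m)" for y
  proof -
    have "pverts (layer_graph k m) = {..<2 * k * m}"
      by (simp add: layer_graph_def)
    with y obtain u where u: "u < 2 * k * m" "y = out_degree (with_proj (layer_graph k m)) u"
      by auto
    show ?thesis
    proof (cases "u < 2 * k")
      case True
      then show ?thesis
        using u(2) out_degree_big[of k m u] assms by simp
    next
      case False
      then have "y \<le> k + m"
        using u out_degree_small[of k m u] assms by simp
      with \<open>k + m \<le> (k - 1) * (m + 1) + 2\<close> show ?thesis
        by (rule order_trans[rotated])
    qed
  qed
qed

section \<open>Choice of the parameters\<close>

theorem mainTheorem2:
  fixes \<alpha> n :: nat
  assumes "\<alpha> \<ge> 2"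
    and "n > 0"
    and "(2 * \<alpha> + 2) dvd n"
    and "n \<ge> 4 * \<alpha> + 4"
  shows "\<exists>G :: nat pair_pre_digraph.
    circular_arc_graph G \<and>
    card (pverts G) = n \<and>
    real (max_degree G) =
      real n * (real \<alpha> - 1) / (2 * real \<alpha>)
      + real n / (2 * real \<alpha> * (real \<alpha> + 1)) + (real \<alpha> + 2) \<and>
    boxicity G > \<alpha>"
proof -
  obtain m where n: "n = (2 * \<alpha> + 2) * m"
    using assms(3) by blast
  \<comment> \<open>Layers 0 and 1 must both be present for the degree count of the big
    arcs.\<close>
  have m: "m \<ge> 2"
  proof (rule ccontr)
    assume "\<not> m \<ge> 2"
    then have "(2 * \<alpha> + 2) * m \<le> (2 * \<alpha> + 2) * 1"
      by (intro mult_le_mono2) simp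
    with assms(4) show False
      unfolding n by simp
  qed
  \<comment> \<open>The two fractions add up to \<open>n * \<alpha> / (2 * (\<alpha> + 1))\<close>,
    which is \<open>\<alpha> * m\<close>.\<close>
  have degree: "real (\<alpha> * (m + 1) + 2) =
      real n * (real \<alpha> - 1) / (2 * real \<alpha>)
      + real n / (2 * real \<alpha> * (real \<alpha> + 1)) + (real \<alpha> + 2)"
    using assms(1) by (simp add: n divide_simps) (simp add: algebra_simps)
  show ?thesis
  proof (intro exI[of _ "layer_graph (\<alpha> + 1) m"] conjI)
    show "circular_arc_graph (layer_graph (\<alpha> + 1) m)"
      by (rule circular_arc_graph_layer_graph) simp
    show "card (pverts (layer_graph (\<alpha> + 1) m)) = n"
      by (simp add: layer_graph_def n)
    show "real (max_degree (layer_graph (\<alpha> + 1) m)) =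
      real n * (real \<alpha> - 1) / (2 * real \<alpha>)
      + real n / (2 * real \<alpha> * (real \<alpha> + 1)) + (real \<alpha> + 2)"
      using max_degree_layer_graph[of "\<alpha> + 1" m] assms(1) m degree by simp
    show "\<alpha> < boxicity (layer_graph (\<alpha> + 1) m)"
      using boxicity_layer_graph[of m "\<alpha> + 1"] m by simp
  qed
qed

end
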